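(* If $M$ is a holomorphic homogeneous regular (HHR) manifold, then $M$ is also a weakly holomorphic homogeneous regular (wHHR) manifold.
   Context: $\mathbb{B}^m\subset\mathbb{C}^m$ is the open unit ball and $g_{\mathrm{Euc}}$ is the Euclidean metric on $\mathbb{C}^m$. HHR: a complex $m$-manifold $M$ is an HHR manifold if there exists $s>0$ such that for every $\zeta\in M$ there is a holomorphic embedding $f:M\to\mathbb{C}^m$ with $f(\zeta)=0$ and $s\mathbb{B}^m\subset f(M)\subset\mathbb{B}^m$. Levi form: for a $\mathcal{C}^2$ real-valued function $f$ on a complex $m$-manifold, $\mathscr{L}(f)=\sum_{1\le j,k\le m}\frac{\partial^2 f}{\partial z^j\partial\bar z^k}\,dz^j\otimes d\bar z^k$ in local holomorphic coordinates. For $f$ on $\mathbb{B}^m$, the inequality $\mathscr{L}(f)\ge c\, g_{\mathrm{Euc}}$ means $\sum_{j,k}\frac{\partial^2 f}{\partial z^j\partial\bar z^k}(w)\,x_j\bar x_k\ge c\sum_j|x_j|^2$ for all $w\in\mathbb{B}^m$ and $x\in\mathbb{C}^m$. wHHR: a complex $m$-manifold $M$ is a wHHR manifold if there exists $s>0$ such that for every $\zeta\in M$ there exist a holomorphic embedding $\Phi:\mathbb{B}^m\to M$ and a $\mathcal{C}^2$ plurisubharmonic function $\phi:M\to[0,1]$ with $\Phi(0)=\zeta$ and $\mathscr{L}(\phi\circ\Phi)\ge s^2 g_{\mathrm{Euc}}$ on $\mathbb{B}^m$. *)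

theory Defs
  imports "HOL-Analysis.Analysis"
begin

section \<open>Holomorphic maps between open subsets of complex coordinate spaces\<close>

text \<open>Only meant for open \<open>S\<close>: the derivative is taken at \<open>z\<close>, not within \<open>S\<close>.\<close>

definition holomorphic_vec_on ::
  "(complex^'m \<Rightarrow> complex^'n) \<Rightarrow> (complex^'m) set \<Rightarrow> bool"  (infix \<open>holomorphic'_vec'_on\<close> 50)
  where "f holomorphic_vec_on S \<longleftrightarrow>
    (\<forall>z\<in>S. \<exists>D. Vector_Spaces.linear (*s) (*s) D \<and> (f has_derivative D) (at z))"


section \<open>Complex manifolds\<close>

text \<open>
  A complex manifold is a topological space \<open>X\<close> with a holomorphic atlas \<open>A\<close>, a set of pairs
  \<open>(U, \<kappa>)\<close> of a chart domain and a coordinate map. The dimension is \<open>CARD('m)\<close>. The atlas need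
  not be maximal; the notions below do not change under passing to a compatible atlas.
  Connectedness is not assumed.
\<close>

type_synonym ('a, 'm) atlas = "('a set \<times> ('a \<Rightarrow> complex^'m)) set"

locale complex_manifold =
  fixes X :: "'a topology" and A :: "('a, 'm::finite) atlas"
  assumes Hausdorff: "Hausdorff_space X"
    and second_countable: "second_countable X"
    and chart_domain: "(U, \<kappa>) \<in> A \<Longrightarrow> openin X U"
    and chart_image: "(U, \<kappa>) \<in> A \<Longrightarrow> open (\<kappa> ` U)"
    and chart_homeomorphic:
      "(U, \<kappa>) \<in> A \<Longrightarrow> homeomorphic_map (subtopology X U) (top_of_set (\<kappa> ` U)) \<kappa>"
    and charts_cover: "topspace X \<subseteq> (\<Union>(U, \<kappa>)\<in>A. U)"
    and transition_holomorphic: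
      "\<lbrakk>(U, \<kappa>) \<in> A; (V, \<mu>) \<in> A\<rbrakk> \<Longrightarrow>
        (\<mu> \<circ> inv_into U \<kappa>) holomorphic_vec_on (\<kappa> ` (U \<inter> V))"

definition holomorphic_map ::
  "'a topology \<Rightarrow> ('a, 'm::finite) atlas \<Rightarrow> 'b topology \<Rightarrow> ('b, 'n::finite) atlas \<Rightarrow>
    ('a \<Rightarrow> 'b) \<Rightarrow> bool"
  where "holomorphic_map X A Y B F \<longleftrightarrow>
    continuous_map X Y F \<and>
    (\<forall>(U, \<kappa>)\<in>A. \<forall>(V, \<mu>)\<in>B.
      (\<mu> \<circ> F \<circ> inv_into U \<kappa>) holomorphic_vec_on (\<kappa> ` (U \<inter> F -` V)))"

definition immersive_map ::
  "('a, 'm::finite) atlas \<Rightarrow> ('b, 'n::finite) atlas \<Rightarrow> ('a \<Rightarrow> 'b) \<Rightarrow> bool"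
  where "immersive_map A B F \<longleftrightarrow>
    (\<forall>(U, \<kappa>)\<in>A. \<forall>(V, \<mu>)\<in>B. \<forall>p \<in> U \<inter> F -` V.
      inj (frechet_derivative (\<mu> \<circ> F \<circ> inv_into U \<kappa>) (at (\<kappa> p))))"

definition holomorphic_embedding ::
  "'a topology \<Rightarrow> ('a, 'm::finite) atlas \<Rightarrow> 'b topology \<Rightarrow> ('b, 'n::finite) atlas \<Rightarrow>
    ('a \<Rightarrow> 'b) \<Rightarrow> bool"
  where "holomorphic_embedding X A Y B F \<longleftrightarrow>
    holomorphic_map X A Y B F \<and> immersive_map A B F \<and> embedding_map X Y F"

text \<open>The standard atlas of an open subset \<open>S\<close> of complex coordinate space.\<close>

definition std_atlas :: "(complex^'m) set \<Rightarrow> (complex^'m, 'm::finite) atlas"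
  where "std_atlas S = {(S, id)}"


section \<open>Real functions of class C2 and the Levi form\<close>

definition C2_on :: "('v::euclidean_space \<Rightarrow> real) \<Rightarrow> 'v set \<Rightarrow> bool"
  where "C2_on f S \<longleftrightarrow>
    (\<exists>(f' :: 'v \<Rightarrow> 'v \<Rightarrow>\<^sub>L real) (f'' :: 'v \<Rightarrow> 'v \<Rightarrow>\<^sub>L ('v \<Rightarrow>\<^sub>L real)).
      (\<forall>x\<in>S. (f has_derivative blinfun_apply (f' x)) (at x)) \<and>
      (\<forall>x\<in>S. (f' has_derivative blinfun_apply (f'' x)) (at x)) \<and>
      continuous_on S f'')"

definition dir_deriv :: "(complex^'m) \<Rightarrow> (complex^'m \<Rightarrow> complex) \<Rightarrow> complex^'m \<Rightarrow> complex"
  where "dir_deriv v f z = vector_derivative (\<lambda>t::real. f (z + t *\<^sub>R v)) (at 0)"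

text \<open>
  The Wirtinger operators
  \<open>\<partial>/\<partial>z\<^sup>j = (\<partial>/\<partial>x\<^sup>j - \<i> \<partial>/\<partial>y\<^sup>j)/2\<close> and \<open>\<partial>/\<partial>\<bar>z\<^sup>k = (\<partial>/\<partial>x\<^sup>k + \<i> \<partial>/\<partial>y\<^sup>k)/2\<close>,
  where \<open>z\<^sup>j = x\<^sup>j + \<i> y\<^sup>j\<close>.
\<close>

definition wirtinger :: "'m \<Rightarrow> (complex^'m \<Rightarrow> complex) \<Rightarrow> complex^'m \<Rightarrow> complex"
  where "wirtinger j f z =
    (dir_deriv (axis j 1) f z - \<i> * dir_deriv (axis j \<i>) f z) / 2"

definition wirtinger_bar :: "'m \<Rightarrow> (complex^'m \<Rightarrow> complex) \<Rightarrow> complex^'m \<Rightarrow> complex"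
  where "wirtinger_bar k f z =
    (dir_deriv (axis k 1) f z + \<i> * dir_deriv (axis k \<i>) f z) / 2"

text \<open>
  For a real function of class C2 the matrix of mixed derivatives is Hermitian, so the sum below
  is real and taking its real part only fixes the type.
\<close>

definition levi_form :: "(complex^'m \<Rightarrow> real) \<Rightarrow> complex^'m \<Rightarrow> complex^'m \<Rightarrow> real"
  where "levi_form f w x =
    Re (\<Sum>j\<in>UNIV. \<Sum>k\<in>UNIV.
      wirtinger j (wirtinger_bar k (\<lambda>z. complex_of_real (f z))) w * (x $ j) * cnj (x $ k))"

definition levi_ge :: "(complex^'m \<Rightarrow> real) \<Rightarrow> (complex^'m) set \<Rightarrow> real \<Rightarrow> bool"
  where "levi_ge f S c \<longleftrightarrow> (\<forall>w\<in>S. \<forall>x. levi_form f w x \<ge> c * (\<Sum>j\<in>UNIV. (cmod (x $ j))\<^sup>2))"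

text \<open>A C2 function is plurisubharmonic iff its Levi form is positive semidefinite everywhere.\<close>

definition C2_plurisubharmonic ::
  "'a topology \<Rightarrow> ('a, 'm::finite) atlas \<Rightarrow> ('a \<Rightarrow> real) \<Rightarrow> bool"
  where "C2_plurisubharmonic X A \<phi> \<longleftrightarrow>
    (\<forall>(U, \<kappa>)\<in>A. C2_on (\<phi> \<circ> inv_into U \<kappa>) (\<kappa> ` U) \<and> levi_ge (\<phi> \<circ> inv_into U \<kappa>) (\<kappa> ` U) 0)"


section \<open>HHR and wHHR manifolds\<close>

definition HHR_manifold :: "'a topology \<Rightarrow> ('a, 'm::finite) atlas \<Rightarrow> bool"
  where "HHR_manifold X A \<longleftrightarrow>
    complex_manifold X A \<and>
    (\<exists>s>0. \<forall>\<zeta>\<in>topspace X. \<exists>f :: 'a \<Rightarrow> complex^'m.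
      holomorphic_embedding X A euclidean (std_atlas UNIV) f \<and>
      f \<zeta> = 0 \<and> ball 0 s \<subseteq> f ` topspace X \<and> f ` topspace X \<subseteq> ball 0 1)"

definition wHHR_manifold :: "'a topology \<Rightarrow> ('a, 'm::finite) atlas \<Rightarrow> bool"
  where "wHHR_manifold X A \<longleftrightarrow>
    complex_manifold X A \<and>
    (\<exists>s>0. \<forall>\<zeta>\<in>topspace X. \<exists>(\<Phi> :: complex^'m \<Rightarrow> 'a) (\<phi> :: 'a \<Rightarrow> real).
      holomorphic_embedding (top_of_set (ball 0 1)) (std_atlas (ball 0 1)) X A \<Phi> \<and>
      C2_plurisubharmonic X A \<phi> \<and> \<phi> \<in> topspace X \<rightarrow> {0..1} \<and>
      \<Phi> 0 = \<zeta> \<and> levi_ge (\<phi> \<circ> \<Phi>) (ball 0 1) (s\<^sup>2))"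

end

theory Submission
  imports Defs "HOL-Complex_Analysis.Cauchy_Integral_Formula"
begin

text \<open>
  Given an embedding \<open>f\<close> with \<open>f \<zeta> = 0\<close> and \<open>sB \<subseteq> f(M) \<subseteq> B\<close>, where \<open>B\<close> is the unit ball, take
  \<open>\<phi> = |f|\<^sup>2\<close> and \<open>\<Phi> w = f\<^sup>-\<^sup>1 (s w)\<close>, so that \<open>\<phi> (\<Phi> w) = s\<^sup>2 |w|\<^sup>2\<close>, whose Levi form is \<open>s\<^sup>2\<close> times the Euclidean
  metric. In a chart \<open>\<phi>\<close> is a sum of squares \<open>|g\<^sub>l|\<^sup>2\<close> of holomorphic functions, whose Levi form at
  \<open>x\<close> is the sum of the \<open>|D g\<^sub>l x|\<^sup>2\<close>. Holomorphy is only complex Frechet differentiability, so that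
  \<open>\<phi>\<close> is of class C2 has to be deduced from the Cauchy integral formula on complex lines, by
  differentiating under the integral sign. The derivative of \<open>\<Phi>\<close> is the inverse of that of \<open>f\<close>,
  up to the factor \<open>s\<close>.
\<close>

section \<open>Scalar functions with complex linear derivative\<close>

text \<open>The scalar counterpart of \<open>holomorphic_vec_on\<close>, meant for open
  \<open>S\<close>. Real linearity of \<open>D\<close> comes with \<open>has_derivative\<close>, so
  the homogeneity clause makes \<open>D\<close> complex linear.\<close>

definition complex_frechet_on :: "(complex^'m \<Rightarrow> complex) \<Rightarrow> (complex^'m) set \<Rightarrow> bool"
  where "complex_frechet_on g S \<longleftrightarrow>
    (\<forall>z\<in>S. \<exists>D. (g has_derivative D) (at z) \<and> (\<forall>c x. D (c *s x) = c * D x))"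

lemma complex_frechet_on_has_derivative:
  assumes "complex_frechet_on g S" "z \<in> S"
  shows "(g has_derivative frechet_derivative g (at z)) (at z)"
  using assms frechet_derivative_works
  unfolding complex_frechet_on_def differentiable_def by blast

lemma complex_frechet_on_linear:
  assumes "complex_frechet_on g S" "z \<in> S"
  shows "frechet_derivative g (at z) (c *s x) = c * frechet_derivative g (at z) x"
  using assms frechet_derivative_at unfolding complex_frechet_on_def by metis

lemma complex_frechet_on_continuous:
  assumes "complex_frechet_on g S"
  shows "continuous_on S g"
  using assms
  by (meson complex_frechet_on_has_derivative continuous_at_imp_continuous_on has_derivative_continuous)

section \<open>Cauchy's formula on complex lines and higher differentiability\<close>

lemma norm_vector_smult: "norm (c *s (v :: complex^'m)) = cmod c * norm v"
  by (simp add: norm_vec_def L2_set_right_distrib norm_mult)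

lemma bounded_linear_vector_smult_left: "bounded_linear (\<lambda>c. c *s (v :: complex^'m))"
  by (rule bounded_linear_intro[where K = "norm v"])
     (simp_all add: vec_eq_iff algebra_simps norm_vector_smult)

lemma continuous_on_vector_smult [continuous_intros]:
  fixes v :: "complex^'m"
  assumes "continuous_on T c"
  shows "continuous_on T (\<lambda>t. c t *s v)"
  using bounded_linear.continuous_on[OF bounded_linear_vector_smult_left assms] .

text \<open>Restricted to the complex line through \<open>z\<close> in direction \<open>v\<close>,
  \<open>g\<close> is holomorphic in one variable, and Cauchy's formula gives its derivative at 0.
  The right side contains only values of \<open>g\<close>, with \<open>z\<close> as a parameter, so
  that it can be differentiated again.\<close>

lemma Cauchy_directional_derivative:
  fixes g :: "complex^'m \<Rightarrow> complex"
  assumes g: "complex_frechet_on g S" and S: "open S" and r: "r > 0"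
    and sub: "\<And>\<xi>. cmod \<xi> \<le> r \<Longrightarrow> z + \<xi> *s v \<in> S"
  shows "frechet_derivative g (at z) v =
    integral {0..1} (\<lambda>t. g (z + circlepath 0 r t *s v) / circlepath 0 r t)"
proof -
  define h where "h = (\<lambda>\<xi>. g (z + \<xi> *s v))"
  \<comment> \<open>By complex linearity the real derivative of \<open>h\<close> is multiplication
    by a complex number, which is complex differentiability.\<close>
  have der: "(h has_field_derivative frechet_derivative g (at (z + \<xi> *s v)) v) (at \<xi>)"
    if "cmod \<xi> \<le> r" for \<xi>
  proof -
    have in_S: "z + \<xi> *s v \<in> S" using sub that .
    have "((\<lambda>\<xi>. z + \<xi> *s v) has_derivative (\<lambda>c. c *s v)) (at \<xi>)"
      using bounded_linear_imp_has_derivative[OF bounded_linear_vector_smult_left]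
      by (auto intro!: derivative_eq_intros)
    then have "(h has_derivative (\<lambda>c. frechet_derivative g (at (z + \<xi> *s v)) (c *s v))) (at \<xi>)"
      unfolding h_def
      by (rule has_derivative_compose) (use complex_frechet_on_has_derivative[OF g in_S] in auto)
    then show ?thesis
      by (simp add: complex_frechet_on_linear[OF g in_S] has_field_derivative_def mult_commute_abs)
  qed
  have contf: "continuous_on (cball 0 r) h"
    using der by (intro continuous_at_imp_continuous_on) (metis DERIV_isCont dist_0_norm mem_cball)
  have holf: "h holomorphic_on ball 0 r"
    unfolding holomorphic_on_def field_differentiable_def
    using der has_field_derivative_at_within by (metis dist_0_norm less_imp_le mem_ball)
  have "frechet_derivative g (at z) v = 1 / (2 * of_real pi * \<i>) *
      contour_integral (circlepath 0 r) (\<lambda>u. h u / (u - 0)^2)"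
  proof (rule DERIV_unique)
    show "(h has_field_derivative frechet_derivative g (at z) v) (at 0)"
      using der[of 0] r by simp
  qed (use Cauchy_derivative_integral_circlepath(2)[OF contf holf, of 0] r in simp)
  \<comment> \<open>On the circle du = 2 pi i u dt, which cancels the constant in front and one of
    the two factors \<open>u\<close> in the denominator.\<close>
  also have "\<dots> = integral {0..1} (\<lambda>t. h (circlepath 0 r t) / circlepath 0 r t)"
  proof -
    have nz: "circlepath 0 r t \<noteq> 0" for t
      using r by (simp add: circlepath)
    have dc: "vector_derivative (circlepath 0 r) (at t) = 2 * of_real pi * \<i> * circlepath 0 r t" for t
      unfolding vector_derivative_circlepath by (simp add: circlepath)
    show ?thesis
      unfolding contour_integral_integral integral_mult_right[symmetric] dc
      using nz by (intro integral_cong) (simp add: power2_eq_square divide_simps)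
  qed
  finally show ?thesis unfolding h_def .
qed

text \<open>One radius \<open>r\<close> has to serve all \<open>z\<close> near \<open>z0\<close>, so
  that the circle of integration stays fixed while \<open>z\<close> varies.\<close>

lemma directional_disc_subset:
  fixes z0 v :: "complex^'m"
  assumes "open S" "z0 \<in> S"
  obtains d r where "d > 0" "r > 0"
    "\<And>z \<xi>. \<lbrakk>z \<in> ball z0 d; cmod \<xi> \<le> r\<rbrakk> \<Longrightarrow> z + \<xi> *s v \<in> S"
proof -
  obtain R where R: "R > 0" "ball z0 R \<subseteq> S" using assms openE by blast
  \<comment> \<open>Half of \<open>R\<close> is left for the distance of \<open>z\<close> from
    \<open>z0\<close> and half for the disc; the \<open>+ 1\<close> covers
    \<open>v = 0\<close>.\<close>
  define r where "r = R / (2 * (norm v + 1))"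
  have r: "r > 0" using R by (simp add: r_def add_nonneg_pos)
  have "z + \<xi> *s v \<in> S" if "z \<in> ball z0 (R/2)" "cmod \<xi> \<le> r" for z \<xi>
  proof -
    have "norm (\<xi> *s v) \<le> r * (norm v + 1)"
      unfolding norm_vector_smult using that r by (intro mult_mono) auto
    also have "\<dots> = R / 2"
      using add_nonneg_pos[OF norm_ge_zero[of v] zero_less_one] unfolding r_def
      by (simp add: divide_simps)
    finally have "dist z0 (z + \<xi> *s v) < R"
      using that norm_triangle_ineq4[of "z0 - z" "\<xi> *s v"]
      by (simp add: dist_norm algebra_simps)
    then show ?thesis using R by auto
  qed
  then show thesis using that[of "R/2" r] R r by auto
qed

text \<open>Kept general in \<open>h\<close>: it is applied to \<open>g\<close> for the Cauchy
  integrand and to directional derivatives of \<open>g\<close> for the derivative of that integrand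
  in \<open>z\<close>.\<close>

lemma continuous_on_circle_quotient:
  fixes v :: "complex^'m"
  assumes h: "continuous_on S h" and r: "r > 0"
    and sub: "\<And>z \<xi>. \<lbrakk>z \<in> U; cmod \<xi> \<le> r\<rbrakk> \<Longrightarrow> z + \<xi> *s v \<in> S"
  shows "continuous_on (U \<times> cbox 0 (1::real))
    (\<lambda>(z, t). h (z + circlepath 0 r t *s v) / circlepath 0 r t :: complex)"
proof -
  have "continuous_on (U \<times> cbox 0 1) (\<lambda>p. h (fst p + circlepath 0 r (snd p) *s v))"
    by (rule continuous_on_compose2[OF h])
       (use r in \<open>auto intro!: continuous_intros sub simp: circlepath norm_mult\<close>)
  then show ?thesis
    unfolding split_beta using r
    by (intro continuous_on_divide) (auto intro!: continuous_intros simp: circlepath)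
qed

text \<open>Near each point the derivative is a Cauchy integral over a fixed circle, with an
  integrand jointly continuous because \<open>g\<close> is. This is the continuity that the Leibniz
  rule asks for in the next lemma.\<close>

lemma continuous_on_directional_derivative:
  assumes g: "complex_frechet_on g S" and S: "open S"
  shows "continuous_on S (\<lambda>z. frechet_derivative g (at z) v)"
proof (intro continuous_at_imp_continuous_on ballI)
  fix z0 assume "z0 \<in> S"
  then obtain d r where d: "d > 0" "r > 0"
    and sub: "\<And>z \<xi>. \<lbrakk>z \<in> ball z0 d; cmod \<xi> \<le> r\<rbrakk> \<Longrightarrow> z + \<xi> *s v \<in> S"
    using directional_disc_subset[OF S] by metis
  have "continuous_on (ball z0 d) (\<lambda>z. integral (cbox 0 1)
      (\<lambda>t. g (z + circlepath 0 r t *s v) / circlepath 0 r t))"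
    by (intro integral_continuous_on_param
        continuous_on_circle_quotient[OF complex_frechet_on_continuous[OF g] d(2) sub])
  then have "continuous_on (ball z0 d) (\<lambda>z. frechet_derivative g (at z) v)"
    by (rule continuous_on_eq) (simp add: Cauchy_directional_derivative[OF g S d(2) sub])
  then show "isCont (\<lambda>z. frechet_derivative g (at z) v) z0"
    using d by (simp add: continuous_on_eq_continuous_at)
qed

text \<open>Differentiating Cauchy's integral under the integral sign shows that the class is closed
  under directional derivatives. Iterating this gives all the smoothness used later.\<close>

lemma complex_frechet_on_directional_derivative:
  assumes g: "complex_frechet_on g S" and S: "open S"
  shows "complex_frechet_on (\<lambda>z. frechet_derivative g (at z) v) S"
  unfolding complex_frechet_on_def
proof
  fix z0 assume "z0 \<in> S"
  then obtain d r where d: "d > 0" "r > 0"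
    and sub: "\<And>z \<xi>. \<lbrakk>z \<in> ball z0 d; cmod \<xi> \<le> r\<rbrakk> \<Longrightarrow> z + \<xi> *s v \<in> S"
    using directional_disc_subset[OF S] by metis
  define c where "c = circlepath 0 r"
  have c: "cmod (c t) \<le> r" "c t \<noteq> 0" for t
    using d by (simp_all add: c_def circlepath norm_mult)
  \<comment> \<open>The derivative in \<open>z\<close> of the Cauchy integrand, packaged as a
    bounded linear map for the Leibniz rule.\<close>
  define fx where "fx = (\<lambda>z t. Blinfun (\<lambda>u. frechet_derivative g (at (z + c t *s v)) u / c t))"
  have fx: "blinfun_apply (fx z t) = (\<lambda>u. frechet_derivative g (at (z + c t *s v)) u / c t)"
    if "z \<in> ball z0 d" for z t
    unfolding fx_def
    using complex_frechet_on_has_derivative[OF g sub[OF that c(1)], THEN has_derivative_bounded_linear]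
    by (intro bounded_linear_Blinfun_apply bounded_linear_compose[OF bounded_linear_divide]) 
  \<comment> \<open>In finite dimension continuity in operator norm can be tested on basis vectors,
    where it is continuity of a directional derivative.\<close>
  have cont: "continuous_on (ball z0 d \<times> cbox 0 1) (\<lambda>(z, t). fx z t)"
  proof (rule continuous_on_blinfun_componentwise)
    fix i :: "complex^'a"
    have "continuous_on (ball z0 d \<times> cbox 0 1)
        (\<lambda>(z, t). frechet_derivative g (at (z + c t *s v)) i / c t)"
      unfolding c_def
      by (intro continuous_on_circle_quotient[OF continuous_on_directional_derivative[OF g S] d(2) sub])
    then show "continuous_on (ball z0 d \<times> cbox 0 1) (\<lambda>p. blinfun_apply (case p of (z, t) \<Rightarrow> fx z t) i)"
      by (rule continuous_on_eq) (auto simp: fx)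
  qed
  \<comment> \<open>Generic in the codomain, since it yields integrability in \<open>t\<close> both
    of the complex integrand and of the operator-valued \<open>fx\<close>.\<close>
  have slice: "continuous_on (cbox 0 1) (F z)"
    if "continuous_on (ball z0 d \<times> cbox 0 1) (\<lambda>(z, t). F z t)" "z \<in> ball z0 d"
    for F :: "complex^'a \<Rightarrow> real \<Rightarrow> 'b::topological_space" and z
    using continuous_on_compose2[OF that(1), of "cbox 0 1" "\<lambda>t. (z, t)"] that(2)
    by (force intro: continuous_on_Pair)
  define J where "J = integral (cbox 0 1) (fx z0)"
  have "((\<lambda>z. integral (cbox 0 1) (\<lambda>t. g (z + c t *s v) / c t)) has_derivative J)
      (at z0 within ball z0 d)"
    unfolding J_def
  proof (rule leibniz_rule[OF _ _ cont])
    fix z t assume z: "z \<in> ball z0 d"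
    have "((\<lambda>z. g (z + c t *s v)) has_derivative frechet_derivative g (at (z + c t *s v))) (at z)"
      by (rule has_derivative_compose[where g = g])
         (auto intro!: derivative_eq_intros complex_frechet_on_has_derivative[OF g sub[OF z c(1)]])
    then show "((\<lambda>z. g (z + c t *s v) / c t) has_derivative blinfun_apply (fx z t)) (at z within ball z0 d)"
      unfolding fx[OF z]
      by (rule has_derivative_at_withinI[OF bounded_linear.has_derivative[OF bounded_linear_divide]])
  next
    fix z assume "z \<in> ball z0 d"
    then show "(\<lambda>t. g (z + c t *s v) / c t) integrable_on cbox 0 1"
      unfolding c_def
      by (intro integrable_continuous slice[OF
          continuous_on_circle_quotient[OF complex_frechet_on_continuous[OF g] d(2) sub]])
  qed (use d in auto)
  then have "((\<lambda>z. integral (cbox 0 1) (\<lambda>t. g (z + c t *s v) / c t)) has_derivative J) (at z0)"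
    using d by (simp only: at_within_open[of z0 "ball z0 d"] centre_in_ball open_ball)
  then have "((\<lambda>z. frechet_derivative g (at z) v) has_derivative J) (at z0)"
    by (rule has_derivative_transform_within_open[where s = "ball z0 d"])
       (use d in \<open>simp_all add: c_def Cauchy_directional_derivative[OF g S d(2) sub]\<close>)
  \<comment> \<open>Evaluation at \<open>x\<close> commutes with the integral, so \<open>J\<close>
    inherits complex homogeneity from the derivatives under the integral sign.\<close>
  moreover have "J (a *s x) = a * J x" for a x
  proof -
    have "fx z0 integrable_on cbox 0 1"
      by (intro integrable_continuous slice[OF cont]) (use d in simp)
    then have J: "J x = integral (cbox 0 1) (\<lambda>t. frechet_derivative g (at (z0 + c t *s v)) x / c t)" for x
      unfolding J_def using d by (simp add: blinfun_apply_integral fx)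
    have "frechet_derivative g (at (z0 + c t *s v)) (a *s x) / c t =
        a * (frechet_derivative g (at (z0 + c t *s v)) x / c t)" for t
      using complex_frechet_on_linear[OF g sub[OF _ c(1)], of z0] d by simp
    then show ?thesis
      unfolding J by (simp only: integral_mult_right)
  qed
  ultimately show "\<exists>D. ((\<lambda>z. frechet_derivative g (at z) v) has_derivative D) (at z0) \<and>
      (\<forall>c x. D (c *s x) = c * D x)"
    by blast
qed

section \<open>Class C2 and the Levi form for sums of squared moduli\<close>

lemma C2_onI_directional:
  fixes f :: "'v::euclidean_space \<Rightarrow> real"
  assumes D: "\<And>z. z \<in> S \<Longrightarrow> (f has_derivative D z) (at z)"
    and D2: "\<And>z b. \<lbrakk>z \<in> S; b \<in> Basis\<rbrakk> \<Longrightarrow> ((\<lambda>z. D z b) has_derivative D2 b z) (at z)"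
    and cont: "\<And>b i. \<lbrakk>b \<in> Basis; i \<in> Basis\<rbrakk> \<Longrightarrow> continuous_on S (\<lambda>z. D2 b z i)"
  shows "C2_on f S"
proof -
  \<comment> \<open>A linear functional is the combination of the inner products with basis vectors
    whose coefficients are its values on the basis. Only scalar coefficients vary with
    \<open>z\<close>, so operator-valued differentiability and continuity reduce to theirs.\<close>
  define f' where "f' = (\<lambda>z. \<Sum>b\<in>Basis. D z b *\<^sub>R blinfun_inner_left b)"
  define f'' where "f'' = (\<lambda>z. Blinfun (\<lambda>u. \<Sum>b\<in>Basis. D2 b z u *\<^sub>R blinfun_inner_left b))"
  have f': "blinfun_apply (f' z) = D z" if "z \<in> S" for z
  proof
    fix v
    interpret D: bounded_linear "D z"
      using D[OF that] by (rule has_derivative_bounded_linear)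
    have "D z v = D z (\<Sum>b\<in>Basis. (v \<bullet> b) *\<^sub>R b)" by (simp add: euclidean_representation)
    then show "blinfun_apply (f' z) v = D z v"
      by (simp add: f'_def blinfun.sum_left blinfun.scaleR_left D.sum D.scaleR mult.commute)
  qed
  have der: "(f' has_derivative (\<lambda>u. \<Sum>b\<in>Basis. D2 b z u *\<^sub>R blinfun_inner_left b)) (at z)"
    if "z \<in> S" for z
    unfolding f'_def
    by (intro has_derivative_sum has_derivative_scaleR_left D2 that)
  have f'': "blinfun_apply (f'' z) = (\<lambda>u. \<Sum>b\<in>Basis. D2 b z u *\<^sub>R blinfun_inner_left b)"
    if "z \<in> S" for z
    unfolding f''_def
    by (rule bounded_linear_Blinfun_apply[OF has_derivative_bounded_linear[OF der[OF that]]])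
  have "continuous_on S f''"
  proof (rule continuous_on_blinfun_componentwise)
    fix i :: 'v assume "i \<in> Basis"
    then have "continuous_on S (\<lambda>z. \<Sum>b\<in>Basis. D2 b z i *\<^sub>R blinfun_inner_left b)"
      by (intro continuous_intros cont)
    then show "continuous_on S (\<lambda>z. blinfun_apply (f'' z) i)"
      by (rule continuous_on_eq) (simp add: f'')
  qed
  then show ?thesis
    unfolding C2_on_def using D der f' f'' by (intro exI[of _ f'] exI[of _ f'']) auto
qed

lemma holomorphic_vec_on_component:
  assumes "F holomorphic_vec_on S"
  shows "complex_frechet_on (\<lambda>z. F z $ l) S"
  unfolding complex_frechet_on_def
proof
  fix z assume "z \<in> S"
  then obtain D where lin: "Vector_Spaces.linear (*s) (*s) D" and D: "(F has_derivative D) (at z)"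
    using assms unfolding holomorphic_vec_on_def by blast
  show "\<exists>D. ((\<lambda>z. F z $ l) has_derivative D) (at z) \<and> (\<forall>c x. D (c *s x) = c * D x)"
  proof (intro exI conjI allI)
    show "((\<lambda>z. F z $ l) has_derivative (\<lambda>x. D x $ l)) (at z)"
      using D by (rule bounded_linear.has_derivative[OF bounded_linear_vec_nth])
    show "D (c *s x) $ l = c * D x $ l" for c x
      by (simp add: vec.linear_scale[OF lin])
  qed
qed

lemma norm_vec_squared: "(norm (x :: complex^'m))\<^sup>2 = (\<Sum>l\<in>UNIV. (cmod (x $ l))\<^sup>2)"
  by (simp add: norm_vec_def L2_set_def sum_nonneg)


text \<open>The product rule expresses the second derivatives by the \<open>g l\<close> and their
  first and second directional derivatives, all of which are again complex differentiable and hence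
  continuous.\<close>

lemma C2_on_sum_cmod_squared:
  fixes g :: "'l::finite \<Rightarrow> complex^'m \<Rightarrow> complex"
  assumes g: "\<And>l. complex_frechet_on (g l) S" and S: "open S"
    and f: "\<And>z. z \<in> S \<Longrightarrow> f z = (\<Sum>l\<in>UNIV. (cmod (g l z))\<^sup>2)"
  shows "C2_on f S"
proof -
  define d where "d = (\<lambda>v l z. frechet_derivative (g l) (at z) v)"
  have d: "complex_frechet_on (d v l) S" for v l
    unfolding d_def by (rule complex_frechet_on_directional_derivative[OF g S])
  define dd where "dd = (\<lambda>w v l z. frechet_derivative (d v l) (at z) w)"
  have dd: "complex_frechet_on (dd w v l) S" for w v l
    unfolding dd_def by (rule complex_frechet_on_directional_derivative[OF d S])
  have hg: "(g l has_derivative (\<lambda>v. d v l z)) (at z)" if "z \<in> S" for l z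
    using complex_frechet_on_has_derivative[OF g that] by (simp add: d_def)
  have hd: "(d v l has_derivative (\<lambda>w. dd w v l z)) (at z)" if "z \<in> S" for v l z
    using complex_frechet_on_has_derivative[OF d that] by (simp add: dd_def)
  note [continuous_intros] = g[THEN complex_frechet_on_continuous]
    d[THEN complex_frechet_on_continuous] dd[THEN complex_frechet_on_continuous]
  show ?thesis
  proof (rule C2_onI_directional)
    fix z assume z: "z \<in> S"
    \<comment> \<open>Writing the squared modulus as \<open>Re (g * cnj g)\<close> makes the product
      rule available while keeping the function real-valued.\<close>
    have "((\<lambda>z. \<Sum>l\<in>UNIV. Re (g l z * cnj (g l z))) has_derivative
        (\<lambda>v. \<Sum>l\<in>UNIV. Re (g l z * cnj (d v l z) + d v l z * cnj (g l z)))) (at z)"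
      by (intro has_derivative_sum has_derivative_Re has_derivative_mult has_derivative_cnj hg z)
    then show "(f has_derivative (\<lambda>v. \<Sum>l\<in>UNIV. Re (g l z * cnj (d v l z) + d v l z * cnj (g l z)))) (at z)"
      by (rule has_derivative_transform_within_open[OF _ S z])
         (simp add: f cmod_power2 flip: power2_eq_square)
  next
    fix z b assume z: "z \<in> S"
    show "((\<lambda>z. \<Sum>l\<in>UNIV. Re (g l z * cnj (d b l z) + d b l z * cnj (g l z))) has_derivative
        (\<lambda>w. \<Sum>l\<in>UNIV. Re ((g l z * cnj (dd w b l z) + d w l z * cnj (d b l z)) +
          (d b l z * cnj (d w l z) + dd w b l z * cnj (g l z))))) (at z)"
      by (intro has_derivative_sum has_derivative_Re has_derivative_add has_derivative_mult
          has_derivative_cnj hg hd z)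
  qed (intro continuous_intros)
qed

lemma dir_deriv_eq:
  assumes "(f has_derivative D) (at z)"
  shows "dir_deriv v f z = D v"
proof -
  interpret D: bounded_linear D using assms by (rule has_derivative_bounded_linear)
  have "((\<lambda>t. z + t *\<^sub>R v) has_derivative (\<lambda>t. t *\<^sub>R v)) (at 0)"
    by (auto intro!: derivative_eq_intros)
  then have "((\<lambda>t::real. f (z + t *\<^sub>R v)) has_derivative (\<lambda>t. D (t *\<^sub>R v))) (at 0)"
    by (rule has_derivative_compose) (use assms in simp)
  then show ?thesis
    unfolding dir_deriv_def
    by (intro vector_derivative_at) (simp add: has_vector_derivative_def D.scaleR)
qed

text \<open>\<open>wirtinger_bar\<close> annihilates holomorphic functions and
  \<open>wirtinger\<close> their conjugates. The Levi matrix is therefore a sum over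
  \<open>l\<close> of matrices a_j * cnj a_k, with a_j the j-th partial derivative of
  \<open>g l\<close>. Contracting with \<open>x\<close> gives the squared modulus of the sum of the
  a_j x_j, which is the derivative at \<open>x\<close>.\<close>

lemma levi_form_sum_cmod_squared:
  fixes g :: "'l::finite \<Rightarrow> complex^'m \<Rightarrow> complex"
  assumes g: "\<And>l. complex_frechet_on (g l) S" and S: "open S" and w: "w \<in> S"
    and f: "\<And>z. z \<in> S \<Longrightarrow> f z = (\<Sum>l\<in>UNIV. (cmod (g l z))\<^sup>2)"
  shows "levi_form f w x = (\<Sum>l\<in>UNIV. (cmod (frechet_derivative (g l) (at w) x))\<^sup>2)"
proof -
  define d where "d = (\<lambda>v l z. frechet_derivative (g l) (at z) v)"
  have d: "complex_frechet_on (d v l) S" for v l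
    unfolding d_def by (rule complex_frechet_on_directional_derivative[OF g S])
  have hg: "(g l has_derivative (\<lambda>v. d v l z)) (at z)" if "z \<in> S" for l z
    using complex_frechet_on_has_derivative[OF g that] by (simp add: d_def)
  have axis_smult: "axis k \<i> = \<i> *s axis k 1" for k :: 'm
    by (simp add: vec_eq_iff axis_def)
  \<comment> \<open>These are the Cauchy-Riemann equations; they drive the cancellations in both
    Wirtinger derivatives below.\<close>
  have d_axis: "d (axis k \<i>) l z = \<i> * d (axis k 1) l z" if "z \<in> S" for k l z
    unfolding d_def axis_smult by (rule complex_frechet_on_linear[OF g that])
  \<comment> \<open>The terms with \<open>cnj (g l z)\<close> cancel and the others double. The
    formula is proved on all of \<open>S\<close> because it is differentiated once more.\<close>
  have bar: "wirtinger_bar k (\<lambda>z. complex_of_real (f z)) z =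
      (\<Sum>l\<in>UNIV. g l z * cnj (d (axis k 1) l z))" if z: "z \<in> S" for k z
  proof -
    have "((\<lambda>z. \<Sum>l\<in>UNIV. g l z * cnj (g l z)) has_derivative
        (\<lambda>v. \<Sum>l\<in>UNIV. g l z * cnj (d v l z) + d v l z * cnj (g l z))) (at z)"
      by (intro has_derivative_sum has_derivative_mult has_derivative_cnj hg z)
    then have "((\<lambda>z. complex_of_real (f z)) has_derivative
        (\<lambda>v. \<Sum>l\<in>UNIV. g l z * cnj (d v l z) + d v l z * cnj (g l z))) (at z)"
      by (rule has_derivative_transform_within_open[OF _ S z])
         (simp add: f flip: complex_norm_square)
    then show ?thesis
      by (simp add: wirtinger_bar_def dir_deriv_eq d_axis[OF z] sum_distrib_left
          sum.distrib[symmetric] sum_divide_distrib algebra_simps)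
  qed
  \<comment> \<open>Here the terms with the second derivatives \<open>dd\<close> cancel, leaving
    products of first derivatives only.\<close>
  have mixed: "wirtinger j (wirtinger_bar k (\<lambda>z. complex_of_real (f z))) w =
      (\<Sum>l\<in>UNIV. d (axis j 1) l w * cnj (d (axis k 1) l w))" for j k
  proof -
    define dd where "dd = (\<lambda>v l. frechet_derivative (d (axis k 1) l) (at w) v)"
    have hd: "(d (axis k 1) l has_derivative (\<lambda>v. dd v l)) (at w)" for l
      using complex_frechet_on_has_derivative[OF d w] by (simp add: dd_def)
    have dd_axis: "dd (axis j \<i>) l = \<i> * dd (axis j 1) l" for l
      unfolding dd_def axis_smult by (rule complex_frechet_on_linear[OF d w])
    have "((\<lambda>z. \<Sum>l\<in>UNIV. g l z * cnj (d (axis k 1) l z)) has_derivative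
        (\<lambda>v. \<Sum>l\<in>UNIV. g l w * cnj (dd v l) + d v l w * cnj (d (axis k 1) l w))) (at w)"
      by (intro has_derivative_sum has_derivative_mult has_derivative_cnj hg hd w)
    then have "((wirtinger_bar k (\<lambda>z. complex_of_real (f z))) has_derivative
        (\<lambda>v. \<Sum>l\<in>UNIV. g l w * cnj (dd v l) + d v l w * cnj (d (axis k 1) l w))) (at w)"
      by (rule has_derivative_transform_within_open[OF _ S w]) (simp add: bar)
    then show ?thesis
      by (simp add: wirtinger_def dir_deriv_eq d_axis[OF w] dd_axis sum_distrib_left
          sum_subtractf[symmetric] sum_divide_distrib algebra_simps)
  qed
  have d_x: "d x l w = (\<Sum>j\<in>UNIV. x $ j * d (axis j 1) l w)" for l
  proof -
    interpret D: bounded_linear "\<lambda>v. d v l w" using hg[OF w] by (rule has_derivative_bounded_linear)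
    have "x = (\<Sum>j\<in>UNIV. x $ j *s axis j 1)" by (simp add: basis_expansion)
    then have "d x l w = (\<Sum>j\<in>UNIV. d (x $ j *s axis j 1) l w)"
      by (metis (no_types, lifting) D.sum sum.cong)
    then show ?thesis
      unfolding d_def by (simp add: complex_frechet_on_linear[OF g w])
  qed
  have "(\<Sum>j\<in>UNIV. \<Sum>k\<in>UNIV.
      (\<Sum>l\<in>UNIV. d (axis j 1) l w * cnj (d (axis k 1) l w)) * (x $ j) * cnj (x $ k)) =
    (\<Sum>l\<in>UNIV. d x l w * cnj (d x l w))"
  proof -
    have "(\<Sum>l\<in>UNIV. d x l w * cnj (d x l w)) = (\<Sum>l\<in>UNIV. \<Sum>j\<in>UNIV. \<Sum>k\<in>UNIV.
        d (axis j 1) l w * cnj (d (axis k 1) l w) * (x $ j) * cnj (x $ k))"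
      unfolding d_x by (simp add: sum_product mult_ac)
    also have "\<dots> = (\<Sum>j\<in>UNIV. \<Sum>l\<in>UNIV. \<Sum>k\<in>UNIV.
        d (axis j 1) l w * cnj (d (axis k 1) l w) * (x $ j) * cnj (x $ k))"
      by (rule sum.swap)
    also have "\<dots> = (\<Sum>j\<in>UNIV. \<Sum>k\<in>UNIV. \<Sum>l\<in>UNIV.
        d (axis j 1) l w * cnj (d (axis k 1) l w) * (x $ j) * cnj (x $ k))"
      by (intro sum.cong refl sum.swap)
    finally show ?thesis by (simp add: sum_distrib_right)
  qed
  then show ?thesis
    unfolding levi_form_def mixed
    by (simp add: d_def complex_norm_square[symmetric] flip: of_real_power)
qed

section \<open>Scaling and inverting a holomorphic embedding\<close>

lemma has_derivative_scaled_component: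
  "((\<lambda>z::complex^'m. of_real s * z $ l) has_derivative (\<lambda>x. of_real s * x $ l)) (at w)"
  by (intro has_derivative_mult_right bounded_linear_imp_has_derivative bounded_linear_vec_nth)

text \<open>In the theorem \<open>f\<close> composed with \<open>\<Phi>\<close> is scaling by
  \<open>s\<close> on the unit ball; its components are fed to the Levi formula.\<close>

lemma complex_frechet_on_scaled_component:
  "complex_frechet_on (\<lambda>z::complex^'m. of_real s * z $ l) S"
  unfolding complex_frechet_on_def
proof
  fix w :: "complex^'m"
  show "\<exists>D. ((\<lambda>z. of_real s * z $ l) has_derivative D) (at w) \<and> (\<forall>c x. D (c *s x) = c * D x)"
    by (rule exI, rule conjI[OF has_derivative_scaled_component]) simp
qed

text \<open>Source and target have equal dimension, so the injective \<open>D\<close> is bijective,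
  and the inverse function theorem gives \<open>inv D\<close> as derivative of \<open>G\<close>. The
  inverse of a complex linear bijection is complex linear. Injectivity of \<open>E\<close> is what
  makes the inverse map immersive.\<close>

lemma holomorphic_local_inverse:
  fixes F :: "complex^'m \<Rightarrow> complex^'m"
  assumes F: "F holomorphic_vec_on S" and S: "open S" and x: "x \<in> S"
    and inj: "inj (frechet_derivative F (at x))"
    and G: "\<And>y. y \<in> S \<Longrightarrow> G (F y) = y"
  obtains E where "(G has_derivative E) (at (F x))" "Vector_Spaces.linear (*s) (*s) E" "inj E"
proof -
  obtain D where lin: "Vector_Spaces.linear (*s) (*s) D" and D: "(F has_derivative D) (at x)"
    using F x unfolding holomorphic_vec_on_def by blast
  have injD: "inj D" using inj frechet_derivative_at[OF D] by simp
  moreover have "linear D" using D has_derivative_linear by blast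
  ultimately have surjD: "surj D" by (rule linear_inj_imp_surj[rotated])
  have "continuous_on S F"
    using F by (meson holomorphic_vec_on_def continuous_at_imp_continuous_on has_derivative_continuous)
  then have "(G has_derivative inv D) (at (F x))"
    using surjD by (intro has_derivative_inverse_strong[OF S x _ G D]) (auto simp: surj_iff)
  moreover have "Vector_Spaces.linear (*s) (*s) (inv D)"
    unfolding Vector_Spaces.linear_iff
  proof (intro conjI allI vec.vector_space_axioms)
    show "inv D (a + b) = inv D a + inv D b" for a b
      by (rule inv_f_eq[OF injD]) (simp add: vec.linear_add[OF lin] surj_f_inv_f[OF surjD])
    show "inv D (c *s a) = c *s inv D a" for c a
      by (rule inv_f_eq[OF injD]) (simp add: vec.linear_scale[OF lin] surj_f_inv_f[OF surjD])
  qed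
  moreover have "inj (inv D)" using surjD by (rule surj_imp_inj_inv)
  ultimately show thesis using that by blast
qed

lemma (in complex_manifold) chart_inverse:
  assumes "(U, \<kappa>) \<in> A"
  shows "U \<subseteq> topspace X" "inj_on \<kappa> U"
  using chart_domain[OF assms] chart_homeomorphic[OF assms]
  by (auto dest: openin_subset simp: homeomorphic_map_def inf_absorb2)

text \<open>Topologically, \<open>f\<close> is a homeomorphism onto its image, which contains the
  ball of radius \<open>s\<close>. Holomorphy and immersivity are local: in a chart the map is a
  local inverse of the chart expression of \<open>f\<close>, preceded by scaling.\<close>

lemma holomorphic_embedding_scaled_inverse:
  fixes A :: "('a, 'm::finite) atlas" and f :: "'a \<Rightarrow> complex^'m"
  assumes M: "complex_manifold X A"
    and f: "holomorphic_embedding X A euclidean (std_atlas UNIV) f"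
    and s: "s > 0" and sub: "ball 0 s \<subseteq> f ` topspace X"
  shows "holomorphic_embedding (top_of_set (ball 0 1)) (std_atlas (ball 0 1)) X A
    (\<lambda>w. inv_into (topspace X) f (s *\<^sub>R w))"
proof -
  interpret complex_manifold X A by fact
  let ?B = "ball 0 1 :: (complex^'m) set"
  define g where "g = inv_into (topspace X) f"
  define \<Phi> where "\<Phi> = (\<lambda>w. g (s *\<^sub>R w))"
  have emb: "homeomorphic_map X (top_of_set (f ` topspace X)) f"
    using f by (simp add: holomorphic_embedding_def embedding_map_def)
  then have injf: "inj_on f (topspace X)" by (simp add: homeomorphic_map_def)
  have contf: "continuous_map X euclidean f"
    using f by (simp add: holomorphic_embedding_def holomorphic_map_def)
  have gf: "g (f p) = p" if "p \<in> topspace X" for p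
    using injf that by (simp add: g_def)
  have fg: "f (g y) = y" "g y \<in> topspace X" if "y \<in> f ` topspace X" for y
    using that by (auto simp: g_def f_inv_into_f inv_into_into)
  have contg: "continuous_map (top_of_set (f ` topspace X)) X g"
  proof -
    obtain g' where g': "homeomorphic_maps X (top_of_set (f ` topspace X)) f g'"
      using emb by (auto simp: homeomorphic_map_maps)
    \<comment> \<open>\<open>g'\<close> and \<open>g\<close> agree on the image, both being inverse
      to \<open>f\<close> there.\<close>
    show ?thesis
      by (rule continuous_map_eq[of _ _ g'])
         (use g' gf in \<open>auto simp: homeomorphic_maps_def\<close>)
  qed
  have scale: "s *\<^sub>R w \<in> f ` topspace X" if "w \<in> ?B" for w
  proof -
    have "norm (s *\<^sub>R w) < s" using that s by simp
    then show ?thesis using sub by (auto simp: mem_ball_0)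
  qed
  have f\<Phi>: "f (\<Phi> w) = s *\<^sub>R w" "\<Phi> w \<in> topspace X" if "w \<in> ?B" for w
    using fg[OF scale[OF that]] by (simp_all add: \<Phi>_def)
  have cont\<Phi>: "continuous_map (top_of_set ?B) X \<Phi>"
  proof -
    have "continuous_map (top_of_set ?B) (top_of_set (f ` topspace X)) (\<lambda>w. s *\<^sub>R w)"
      using scale by (auto simp: continuous_map_in_subtopology intro!: continuous_intros)
    from continuous_map_compose[OF this contg] show ?thesis by (simp add: \<Phi>_def o_def)
  qed
  have emb\<Phi>: "embedding_map (top_of_set ?B) X \<Phi>"
    unfolding embedding_map_def
  proof (rule homeomorphic_maps_imp_map[where g = "\<lambda>p. (1 / s) *\<^sub>R f p"])
    have inv: "(1 / s) *\<^sub>R f (\<Phi> w) = w" if "w \<in> ?B" for w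
      using f\<Phi>[OF that] s by simp
    have "continuous_map X euclidean (\<lambda>p. (1 / s) *\<^sub>R f p)"
      using continuous_map_compose[OF contf, of euclidean "\<lambda>y. (1 / s) *\<^sub>R y"]
      by (simp add: o_def continuous_intros)
    then have "continuous_map (subtopology X (\<Phi> ` ?B)) (top_of_set ?B) (\<lambda>p. (1 / s) *\<^sub>R f p)"
      using inv by (auto simp: continuous_map_in_subtopology continuous_map_from_subtopology)
    then show "homeomorphic_maps (top_of_set ?B) (subtopology X (\<Phi> ` topspace (top_of_set ?B))) \<Phi>
        (\<lambda>p. (1 / s) *\<^sub>R f p)"
      using cont\<Phi> inv by (auto simp: homeomorphic_maps_def continuous_map_in_subtopology)
  qed
  \<comment> \<open>One derivative \<open>E\<close> serves twice: its complex linearity gives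
    holomorphy and its injectivity gives immersivity. The chart inverse
    \<open>inv_into ?B id\<close> is the identity on \<open>?B\<close> only.\<close>
  have loc: "\<exists>E. ((\<mu> \<circ> \<Phi> \<circ> inv_into ?B id) has_derivative E) (at p) \<and>
      Vector_Spaces.linear (*s) (*s) E \<and> inj E"
    if chart: "(V, \<mu>) \<in> A" and p: "p \<in> ?B" "\<Phi> p \<in> V" for V \<mu> p
  proof -
    note V = chart_inverse[OF chart]
    define F where "F = f \<circ> inv_into V \<mu>"
    have F: "F holomorphic_vec_on (\<mu> ` V)"
      using f chart
      by (auto simp: holomorphic_embedding_def holomorphic_map_def std_atlas_def F_def id_comp)
    have imm: "inj (frechet_derivative F (at (\<mu> (\<Phi> p))))"
      using f chart p
      by (auto simp: holomorphic_embedding_def immersive_map_def std_atlas_def F_def id_comp)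
    have Fp: "F (\<mu> (\<Phi> p)) = s *\<^sub>R p"
      using V p f\<Phi> by (simp add: F_def)
    \<comment> \<open>The left inverse is built from the unscaled \<open>g\<close>, because
      \<open>F y\<close> may lie anywhere in the image of \<open>f\<close>, also outside the ball of
      radius \<open>s\<close>.\<close>
    have "(\<mu> \<circ> g) (F y) = y" if "y \<in> \<mu> ` V" for y
      using that V gf by (auto simp: F_def)
    then obtain E where E: "((\<mu> \<circ> g) has_derivative E) (at (s *\<^sub>R p))"
      "Vector_Spaces.linear (*s) (*s) E" "inj E"
      using holomorphic_local_inverse[OF F chart_image[OF chart] imageI[OF p(2)] imm]
      unfolding Fp by metis
    have "((\<lambda>w. (\<mu> \<circ> g) (s *\<^sub>R w)) has_derivative (\<lambda>w. E (s *\<^sub>R w))) (at p)"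
      by (rule has_derivative_compose[where f = "\<lambda>w. s *\<^sub>R w", OF _ E(1)])
         (rule bounded_linear_imp_has_derivative[OF bounded_linear_scaleR_right])
    then have "((\<mu> \<circ> \<Phi> \<circ> inv_into ?B id) has_derivative (\<lambda>w. E (s *\<^sub>R w))) (at p)"
      by (rule has_derivative_transform_within_open[OF _ open_ball p(1)])
         (use inv_into_f_f[of id ?B] in \<open>simp add: \<Phi>_def\<close>)
    moreover have "Vector_Spaces.linear (*s) (*s) (\<lambda>w. E (s *\<^sub>R w))"
    proof -
      \<comment> \<open>Real scaling is rewritten as complex scaling so that complex linearity of
        \<open>E\<close> applies.\<close>
      have "s *\<^sub>R w = of_real s *s w" for w :: "complex^'m"
        unfolding vec_eq_iff vector_scaleR_component by (simp add: scaleR_conv_of_real)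
      then have "E (s *\<^sub>R w) = of_real s *s E w" for w
        by (simp only: vec.linear_scale[OF E(2)])
      then show ?thesis
        using E(2) by (simp add: Vector_Spaces.linear_iff vector_add_ldistrib mult.commute)
    qed
    moreover have "inj (\<lambda>w. E (s *\<^sub>R w))"
      using E(3) s by (auto dest!: injD intro!: injI)
    ultimately show ?thesis by blast
  qed
  have "holomorphic_map (top_of_set ?B) (std_atlas ?B) X A \<Phi>"
    unfolding holomorphic_map_def holomorphic_vec_on_def std_atlas_def
    using cont\<Phi> loc by fastforce
  moreover have "immersive_map (std_atlas ?B) A \<Phi>"
    unfolding immersive_map_def std_atlas_def
    using loc frechet_derivative_at by fastforce
  ultimately show ?thesis
    using emb\<Phi> unfolding holomorphic_embedding_def \<Phi>_def g_def by blast
qed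

section \<open>The squared norm of the embedding, and the passage from HHR to wHHR\<close>

lemma C2_plurisubharmonic_norm_squared:
  fixes f :: "'a \<Rightarrow> complex^'n::finite"
  assumes M: "complex_manifold X A"
    and f: "holomorphic_map X A euclidean (std_atlas UNIV) f"
  shows "C2_plurisubharmonic X A (\<lambda>p. (norm (f p))\<^sup>2)"
  unfolding C2_plurisubharmonic_def
proof (clarify, intro conjI)
  interpret complex_manifold X A by fact
  fix U \<kappa> assume chart: "(U, \<kappa>) \<in> A"
  define F where "F = f \<circ> inv_into U \<kappa>"
  have "F holomorphic_vec_on (\<kappa> ` U)"
    using f chart by (auto simp: holomorphic_map_def std_atlas_def F_def id_comp)
  then have g: "complex_frechet_on (\<lambda>z. F z $ l) (\<kappa> ` U)" for l
    by (rule holomorphic_vec_on_component)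
  note S = chart_image[OF chart]
  \<comment> \<open>In a chart the function is a sum of squared moduli of the components of
    \<open>F\<close>. Hence it is C2, and its Levi form is a sum of squares.\<close>
  have eq: "((\<lambda>p. (norm (f p))\<^sup>2) \<circ> inv_into U \<kappa>) z = (\<Sum>l\<in>UNIV. (cmod (F z $ l))\<^sup>2)" for z
    by (simp add: F_def norm_vec_squared)
  show "C2_on ((\<lambda>p. (norm (f p))\<^sup>2) \<circ> inv_into U \<kappa>) (\<kappa> ` U)"
    by (rule C2_on_sum_cmod_squared[OF g S eq])
  show "levi_ge ((\<lambda>p. (norm (f p))\<^sup>2) \<circ> inv_into U \<kappa>) (\<kappa> ` U) 0"
    unfolding levi_ge_def
  proof (intro ballI allI)
    fix w x assume "w \<in> \<kappa> ` U"
    then show "0 * (\<Sum>j\<in>UNIV. (cmod (x $ j))\<^sup>2) \<le> levi_form ((\<lambda>p. (norm (f p))\<^sup>2) \<circ> inv_into U \<kappa>) w x"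
      by (subst levi_form_sum_cmod_squared[OF g S _ eq]) (auto intro: sum_nonneg)
  qed
qed

theorem mainTheorem8:
  fixes X :: "'a topology" and A :: "('a, 'm::finite) atlas"
  assumes "HHR_manifold X A"
  shows "wHHR_manifold X A"
proof -
  have M: "complex_manifold X A" using assms by (simp add: HHR_manifold_def)
  obtain s where s: "s > 0" and HHR: "\<And>\<zeta>. \<zeta> \<in> topspace X \<Longrightarrow> \<exists>f :: 'a \<Rightarrow> complex^'m.
      holomorphic_embedding X A euclidean (std_atlas UNIV) f \<and>
      f \<zeta> = 0 \<and> ball 0 s \<subseteq> f ` topspace X \<and> f ` topspace X \<subseteq> ball 0 1"
    using assms[unfolded HHR_manifold_def, THEN conjunct2] by (elim exE conjE) (metis (no_types))
  show ?thesis
    unfolding wHHR_manifold_def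
  \<comment> \<open>The HHR constant \<open>s\<close> is kept: it is uniform in
    \<open>\<zeta>\<close> and turns out to be exactly the scaling factor whose square bounds the
    Levi form.\<close>
  proof (intro conjI M exI[of _ s] s ballI)
    fix \<zeta> assume \<zeta>: "\<zeta> \<in> topspace X"
    obtain f :: "'a \<Rightarrow> complex^'m"
      where f: "holomorphic_embedding X A euclidean (std_atlas UNIV) f"
        and f0: "f \<zeta> = 0" and sub: "ball 0 s \<subseteq> f ` topspace X" and bound: "f ` topspace X \<subseteq> ball 0 1"
      using HHR[OF \<zeta>] by blast
    define \<Phi> where "\<Phi> = (\<lambda>w. inv_into (topspace X) f (s *\<^sub>R w))"
    define \<phi> where "\<phi> = (\<lambda>p. (norm (f p))\<^sup>2)"
    have "holomorphic_embedding (top_of_set (ball 0 1)) (std_atlas (ball 0 1)) X A \<Phi>"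
      unfolding \<Phi>_def by (rule holomorphic_embedding_scaled_inverse[OF M f s sub])
    moreover have "C2_plurisubharmonic X A \<phi>"
      using f unfolding \<phi>_def holomorphic_embedding_def
      by (intro C2_plurisubharmonic_norm_squared[OF M]) simp
    moreover have "\<phi> \<in> topspace X \<rightarrow> {0..1}"
    proof
      fix p assume "p \<in> topspace X"
      then have "norm (f p) \<le> 1" using bound by (force simp: image_subset_iff)
      then show "\<phi> p \<in> {0..1}" by (simp add: \<phi>_def power_le_one)
    qed
    moreover have "\<Phi> 0 = \<zeta>"
    proof -
      have "inj_on f (topspace X)"
        using f by (simp add: holomorphic_embedding_def embedding_map_def homeomorphic_map_def)
      then show ?thesis using inv_into_f_f[OF _ \<zeta>, of f] f0 by (simp add: \<Phi>_def)
    qed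
    moreover have "levi_ge (\<phi> \<circ> \<Phi>) (ball 0 1) (s\<^sup>2)"
      unfolding levi_ge_def
    proof (intro ballI allI)
      fix w x :: "complex^'m" assume w: "w \<in> ball 0 1"
      \<comment> \<open>This holds on the unit ball, where \<open>s *\<^sub>R z\<close> lies in the
        image of \<open>f\<close>. As the ball is open, that determines the Levi form at
        \<open>w\<close>.\<close>
      have eq: "(\<phi> \<circ> \<Phi>) z = (\<Sum>l\<in>UNIV. (cmod (of_real s * z $ l))\<^sup>2)" if "z \<in> ball 0 1" for z
      proof -
        have "norm (s *\<^sub>R z) < s" using that s by simp
        then have "s *\<^sub>R z \<in> f ` topspace X" using sub by (auto simp: mem_ball_0)
        then have "f (\<Phi> z) = s *\<^sub>R z" unfolding \<Phi>_def by (rule f_inv_into_f)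
        then show ?thesis by (simp add: \<phi>_def norm_vec_squared norm_mult)
      qed
      \<comment> \<open>Each component of the scaling is linear, hence its own derivative, so the
        required bound holds with equality.\<close>
      have "levi_form (\<phi> \<circ> \<Phi>) w x = (\<Sum>l\<in>UNIV. (cmod (of_real s * x $ l))\<^sup>2)"
        using levi_form_sum_cmod_squared[OF complex_frechet_on_scaled_component open_ball w eq]
        by (simp only: frechet_derivative_at[OF has_derivative_scaled_component, symmetric])
      then show "s\<^sup>2 * (\<Sum>j\<in>UNIV. (cmod (x $ j))\<^sup>2) \<le> levi_form (\<phi> \<circ> \<Phi>) w x"
        by (simp add: norm_mult power_mult_distrib sum_distrib_left)
    qed
    ultimately show "\<exists>(\<Phi> :: complex^'m \<Rightarrow> 'a) (\<phi> :: 'a \<Rightarrow> real).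
      holomorphic_embedding (top_of_set (ball 0 1)) (std_atlas (ball 0 1)) X A \<Phi> \<and>
      C2_plurisubharmonic X A \<phi> \<and> \<phi> \<in> topspace X \<rightarrow> {0..1} \<and>
      \<Phi> 0 = \<zeta> \<and> levi_ge (\<phi> \<circ> \<Phi>) (ball 0 1) (s\<^sup>2)"
      by blast
  qed
qed

end
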